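(* Let $d$ be a positive integer. If $G$ is the $d$-fold Cartesian product of copies of the $n$-vertex path $P_n$, then $$c_\infty(G) \le (1+o(1)) \sum_{k=0}^{\lfloor d/2\rfloor} (-1)^k \binom{d}{k} \binom{\lfloor d(n+1)/2\rfloor - kn - 1}{d-1},$$ where $o(1)$ denotes a quantity tending to $0$ as $n \to \infty$ with $d$ fixed.
   Context: The infinite-speed game of Cops and Robbers on a finite graph $G$: there is a team of cops and one robber, each occupying a vertex of $G$ (several cops may share a vertex), with all positions known to both players. The cops first choose their initial positions; then the robber chooses his initial position. The game proceeds in rounds, each consisting of a cop turn followed by a robber turn. On the cops' turn, each cop either stays at her vertex or moves to a neighboring vertex. On the robber's turn, he may stay put or move along any path in $G$ of arbitrary length starting at his current vertex that does not pass through any vertex occupied by a cop. The cops win if at some point some cop occupies the same vertex as the robber; the robber wins if he evades capture forever. The infinite-speed cop number $c_\infty(G)$ is the minimum number of cops that guarantees a win for the cops on $G$ no matter how the robber plays. *)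

theory Defs
  imports
    Complex_Main
    "HOL-Library.FuncSet"
    "Graph_Theory.Pair_Digraph"
    "Graph_Theory.Vertex_Walk"
begin

text \<open>
  A finite simple graph is represented, as in the Graph Theory library, by a finite symmetric
  loop-free digraph (locale \<open>pair_graph\<close>): an undirected edge is a pair of opposite arcs.
\<close>

definition path_graph :: "nat \<Rightarrow> nat pair_pre_digraph" where
  "path_graph n =
    \<lparr> pverts = {1..n},
      parcs = {(u, v). u \<in> {1..n} \<and> v \<in> {1..n} \<and> (v = Suc u \<or> u = Suc v)} \<rparr>"

definition cartesian_power :: "nat \<Rightarrow> 'a pair_pre_digraph \<Rightarrow> (nat \<Rightarrow> 'a) pair_pre_digraph" where
  "cartesian_power d G =
    \<lparr> pverts = {..<d} \<rightarrow>\<^sub>E pverts G,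
      parcs = {(x, y). x \<in> {..<d} \<rightarrow>\<^sub>E pverts G \<and> y \<in> {..<d} \<rightarrow>\<^sub>E pverts G \<and>
        (\<exists>i<d. (x i, y i) \<in> parcs G \<and> (\<forall>j<d. j \<noteq> i \<longrightarrow> x j = y j))} \<rparr>"

lemma pair_graph_path_graph: "pair_graph (path_graph n)"
proof
  show "finite (parcs (path_graph n))"
    by (rule finite_subset[of _ "{1..n} \<times> {1..n}"]) (auto simp: path_graph_def)
qed (auto simp: path_graph_def symmetric_def sym_def)

lemma pair_graph_cartesian_power:
  assumes "pair_graph G"
  shows "pair_graph (cartesian_power d G)"
proof -
  interpret pair_graph G by fact
  have fin: "finite ({..<d} \<rightarrow>\<^sub>E pverts G)"
    by (intro finite_PiE) (auto intro: pair_finite_verts)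
  show ?thesis
  proof
    show "finite (parcs (cartesian_power d G))"
      by (rule finite_subset[OF _ finite_cartesian_product[OF fin fin]])
        (auto simp: cartesian_power_def)
    have sym: "(b, a) \<in> parcs G" if "(a, b) \<in> parcs G" for a b
      using that pair_sym_arcs by (auto simp: symmetric_def sym_def)
    show "symmetric (with_proj (cartesian_power d G))"
      unfolding symmetric_def
    proof (rule symI)
      fix x y assume "(x, y) \<in> arcs_ends (with_proj (cartesian_power d G))"
      then show "(y, x) \<in> arcs_ends (with_proj (cartesian_power d G))"
        by (auto simp: cartesian_power_def) (metis sym)
    qed
    fix e assume e: "e \<in> parcs (cartesian_power d G)"
    then show "fst e \<noteq> snd e"
      using pair_no_loops by (force simp: cartesian_power_def)
    show "fst e \<in> pverts (cartesian_power d G)" "snd e \<in> pverts (cartesian_power d G)"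
      using e by (simp_all add: cartesian_power_def case_prod_beta)
  next
    show "finite (pverts (cartesian_power d G))"
      using fin by (simp add: cartesian_power_def)
  qed
qed

text \<open>
  The position of a team of \<open>k\<close> cops is a list of \<open>k\<close> vertices. A strategy \<open>\<sigma>\<close> of the cops maps the
  list of all past positions of the robber, oldest first, to the next position of the team;
  \<open>\<sigma> []\<close> is the initial position, chosen before the robber appears. The past positions of the cops
  need not be arguments of \<open>\<sigma>\<close>, since \<open>\<sigma>\<close> determines them.
\<close>

definition cop_strategy :: "'a pair_pre_digraph \<Rightarrow> nat \<Rightarrow> ('a list \<Rightarrow> 'a list) \<Rightarrow> bool" where
  "cop_strategy G k \<sigma> \<longleftrightarrow>
    length (\<sigma> []) = k \<and> set (\<sigma> []) \<subseteq> pverts G \<and>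
    (\<forall>h r. set h \<subseteq> pverts G \<and> r \<in> pverts G \<longrightarrow>
      list_all2 (\<lambda>u v. u = v \<or> (u, v) \<in> parcs G) (\<sigma> h) (\<sigma> (h @ [r])))"

definition robber_move :: "'a pair_pre_digraph \<Rightarrow> 'a set \<Rightarrow> 'a \<Rightarrow> 'a \<Rightarrow> bool" where
  "robber_move G C u v \<longleftrightarrow>
    u = v \<or> (\<exists>p. vpath p (with_proj G) \<and> hd p = u \<and> last p = v \<and> set p \<inter> C = {})"

text \<open>
  In a play, \<open>r t\<close> is the position of the robber after \<open>t\<close> rounds, \<open>r 0\<close> being his initial position.
  The occupied set \<open>cops_at \<sigma> r t\<close> is the one after \<open>t\<close> cop turns, so in round \<open>t + 1\<close> the cops move
  from \<open>cops_at \<sigma> r t\<close> to \<open>cops_at \<sigma> r (Suc t)\<close> and then the robber from \<open>r t\<close> to \<open>r (Suc t)\<close>.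
\<close>

definition cops_at :: "('a list \<Rightarrow> 'a list) \<Rightarrow> (nat \<Rightarrow> 'a) \<Rightarrow> nat \<Rightarrow> 'a set" where
  "cops_at \<sigma> r t = set (\<sigma> (map r [0..<t]))"

definition robber_play ::
    "'a pair_pre_digraph \<Rightarrow> ('a list \<Rightarrow> 'a list) \<Rightarrow> (nat \<Rightarrow> 'a) \<Rightarrow> bool" where
  "robber_play G \<sigma> r \<longleftrightarrow>
    r 0 \<in> pverts G \<and> (\<forall>t. robber_move G (cops_at \<sigma> r (Suc t)) (r t) (r (Suc t)))"

text \<open>
  Capture may happen after a robber turn (or his initial placement) or after a cop turn. Plays are
  formally continued after a capture, which is harmless: staying put is always allowed, and what
  happens after the first capture is irrelevant.
\<close>

definition captured :: "('a list \<Rightarrow> 'a list) \<Rightarrow> (nat \<Rightarrow> 'a) \<Rightarrow> bool" where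
  "captured \<sigma> r \<longleftrightarrow> (\<exists>t. r t \<in> cops_at \<sigma> r t \<or> r t \<in> cops_at \<sigma> r (Suc t))"

definition cops_win :: "'a pair_pre_digraph \<Rightarrow> nat \<Rightarrow> bool" where
  "cops_win G k \<longleftrightarrow> (\<exists>\<sigma>. cop_strategy G k \<sigma> \<and> (\<forall>r. robber_play G \<sigma> r \<longrightarrow> captured \<sigma> r))"

definition cop_number_inf :: "'a pair_pre_digraph \<Rightarrow> nat" where
  "cop_number_inf G = (LEAST k. cops_win G k)"

text \<open>The minimum is attained on finite graphs, so \<open>LEAST\<close> is meaningful there.\<close>

lemma cops_win_card_verts:
  assumes "finite (pverts G)"
  shows "cops_win G (card (pverts G))"
proof -
  obtain xs where xs: "set xs = pverts G" "length xs = card (pverts G)"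
    using finite_distinct_list[OF assms] distinct_card by metis
  have "cop_strategy G (card (pverts G)) (\<lambda>_. xs)"
    using xs by (auto simp: cop_strategy_def intro: list.rel_refl)
  moreover have "captured (\<lambda>_. xs) r" if "robber_play G (\<lambda>_. xs) r" for r
    using that xs by (auto simp: captured_def robber_play_def cops_at_def)
  ultimately show ?thesis unfolding cops_win_def by blast
qed

lemma cops_win_cop_number_inf:
  assumes "finite (pverts G)"
  shows "cops_win G (cop_number_inf G)"
  unfolding cop_number_inf_def by (rule LeastI[of "cops_win G", OF cops_win_card_verts[OF assms]])

text \<open>
  In the bound, floor and subtraction are rendered on \<open>nat\<close>: for \<open>d, n \<ge> 1\<close> and \<open>k \<le> \<lfloor>d/2\<rfloor>\<close> the upper index
  \<open>\<lfloor>d(n+1)/2\<rfloor> - kn - 1\<close> is nonnegative, so nothing is truncated, as the lemma below shows.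
\<close>

lemma middle_layer_upper_index:
  fixes d n k :: nat
  assumes "1 \<le> d" "1 \<le> n" "k \<le> d div 2"
  shows "int (d * (n + 1) div 2 - k * n - 1) = \<lfloor>real (d * (n + 1)) / 2\<rfloor> - int k * int n - 1"
proof -
  have "2 * (k * n) + 2 \<le> d * (n + 1)"
  proof (cases "even d")
    case True
    then have "d \<ge> 2" using assms(1) by (auto elim!: evenE)
    moreover have "2 * k * n \<le> d * n"
      using assms(3) by (intro mult_right_mono) auto
    ultimately have "2 * k * n + 2 \<le> d * n + d" by linarith
    then show ?thesis by (simp only: distrib_left mult.assoc mult_1_right)
  next
    case False
    then have "(2 * k + 1) * n \<le> d * n"
      using assms(3) by (intro mult_right_mono) (auto elim!: oddE)
    then show ?thesis using assms(1,2) by (simp add: algebra_simps)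
  qed
  then have le: "k * n + 1 \<le> d * (n + 1) div 2" by simp
  have "\<lfloor>real (d * (n + 1)) / 2\<rfloor> = int (d * (n + 1) div 2)"
    using floor_divide_of_nat_eq[of "d * (n + 1)" 2] by simp
  then show ?thesis using le by (simp add: of_nat_diff)
qed

end

theory Submission
  imports Defs
begin

text \<open>
  Call the sum of the coordinates of a vertex of the grid \<open>{1..n}\<^sup>d\<close> its weight. Neighbours differ in
  weight by exactly one, so cops who occupy all vertices of weight \<open>t\<close> confine a robber of larger
  weight, no matter how fast he is. It therefore suffices to move the team from each layer to the
  next in a single turn (\<open>cops_win_layer_sweep\<close>), and the question is how many cops this takes.

  The grid, ordered coordinatewise, is a product of chains, and by de Bruijn, Tengbergen and
  Kruyswijk it splits into symmetric chains: saturated chains that run from some weight \<open>a\<close> to the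
  complementary weight \<open>d (n + 1) - a\<close> (\<open>symmetric_chains_exist\<close>). Put one cop on each chain and let
  her stand, after \<open>t\<close> turns, on the vertex of weight \<open>t\<close>, waiting at the bottom of her chain before
  there is one and at its top afterwards. Every vertex of weight \<open>t\<close> lies on some chain, so the
  layer \<open>t\<close> is then occupied. A symmetric chain contains exactly one vertex of the middle weight
  \<open>\<lfloor>d (n + 1) / 2\<rfloor>\<close>, so there are as many cops as vertices in the middle layer. By
  inclusion and exclusion over the coordinates that exceed \<open>n\<close>, this number is the alternating sum
  in question (\<open>card_middle_layer\<close>). So the bound holds without any error term, with \<open>\<epsilon> = 0\<close>.
\<close>

section \<open>Sweeping a graph layer by layer\<close>

text \<open>
  A path that changes the rank by at most one per step cannot skip a rank. Only descents
  matter here, so the bound is asked for in one direction.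
\<close>

lemma vwalk_stays_above_avoided_layer:
  fixes \<rho> :: "'a \<Rightarrow> nat"
  assumes "vwalk p G"
    and "\<And>u v. (u, v) \<in> arcs_ends G \<Longrightarrow> \<rho> u \<le> Suc (\<rho> v)"
    and "\<forall>v\<in>set p. \<rho> v \<noteq> s"
    and "s < \<rho> (hd p)"
  shows "s < \<rho> (last p)"
  using assms(1,3,4)
proof (induction rule: vwalk_induct)
  case (Cons u v es)
  from assms(2)[OF Cons.hyps] Cons.prems have "s < \<rho> v" by fastforce
  with Cons show ?case by simp
qed simp

text \<open>
  The cops follow fixed trajectories \<open>w i\<close> and ignore the robber. At time \<open>t\<close> they occupy the layer of
  rank \<open>t\<close>, so the rank of an uncaptured robber always exceeds the time, although ranks are bounded.
\<close>

lemma cops_win_layer_sweep: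
  fixes \<rho> :: "'a \<Rightarrow> nat" and w :: "'i \<Rightarrow> nat \<Rightarrow> 'a"
  assumes fin: "finite (pverts G)" "finite I"
    and rank: "\<And>u v. (u, v) \<in> parcs G \<Longrightarrow> \<rho> u \<le> Suc (\<rho> v)"
    and start: "\<And>i. i \<in> I \<Longrightarrow> w i 0 \<in> pverts G"
    and step: "\<And>i t. i \<in> I \<Longrightarrow> w i t = w i (Suc t) \<or> (w i t, w i (Suc t)) \<in> parcs G"
    and cover: "\<And>v. v \<in> pverts G \<Longrightarrow> \<exists>i\<in>I. w i (\<rho> v) = v"
  shows "cops_win G (card I)"
proof -
  obtain cs where cs: "set cs = I" "length cs = card I"
    using finite_distinct_list[OF fin(2)] distinct_card by metis
  define \<sigma> where "\<sigma> h = map (\<lambda>i. w i (length h)) cs" for h :: "'a list"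
  have "cop_strategy G (card I) \<sigma>"
    using start step cs
    by (auto simp: cop_strategy_def \<sigma>_def list_all2_map1 list_all2_map2 intro!: list.rel_refl_strong)
  moreover have "captured \<sigma> r" if play: "robber_play G \<sigma> r" for r
  proof (rule ccontr)
    assume free: "\<not> captured \<sigma> r"
    have at: "cops_at \<sigma> r t = (\<lambda>i. w i t) ` I" for t
      using cs by (simp add: cops_at_def \<sigma>_def)
    have occupied: "v \<in> cops_at \<sigma> r (\<rho> v)" if "v \<in> pverts G" for v
      unfolding at using cover[OF that] by (metis imageI)
    have "r t \<in> pverts G \<and> t < \<rho> (r t)" for t
    proof (induction t)
      case 0
      have "r 0 \<in> pverts G" using play by (simp add: robber_play_def)
      moreover have "r 0 \<notin> cops_at \<sigma> r 0" using free by (auto simp: captured_def)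
      ultimately show ?case using occupied[of "r 0"] by (cases "\<rho> (r 0)") auto
    next
      case (Suc t)
      have "r t \<notin> cops_at \<sigma> r (Suc t)" using free by (auto simp: captured_def)
      then have above: "Suc t < \<rho> (r t)"
        using Suc occupied[of "r t"] by (cases "\<rho> (r t) = Suc t") auto
      have "robber_move G (cops_at \<sigma> r (Suc t)) (r t) (r (Suc t))"
        using play by (simp add: robber_play_def)
      then consider "r (Suc t) = r t"
        | p where "vwalk p (with_proj G)" "hd p = r t" "last p = r (Suc t)"
            "set p \<inter> cops_at \<sigma> r (Suc t) = {}"
        by (auto simp: robber_move_def vpath_def)
      then show ?case
      proof cases
        case 1
        then show ?thesis using Suc above by simp
      next
        case (2 p)
        then have p: "set p \<subseteq> pverts G" "p \<noteq> []" by (auto simp: vwalk_def)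
        then have "\<forall>v\<in>set p. \<rho> v \<noteq> Suc t" using 2(4) occupied by fastforce
        then have "Suc t < \<rho> (last p)"
          using vwalk_stays_above_avoided_layer[OF 2(1), of \<rho> "Suc t"] rank above 2(2) by simp
        then show ?thesis using 2(3) p last_in_set[OF p(2)] by auto
      qed
    qed
    then have "Max (\<rho> ` pverts G) < \<rho> (r (Max (\<rho> ` pverts G)))"
      "\<rho> (r (Max (\<rho> ` pverts G))) \<le> Max (\<rho> ` pverts G)"
      using fin(1) by auto
    then show False by simp
  qed
  ultimately show ?thesis unfolding cops_win_def by blast
qed

section \<open>Weights in the grid\<close>

abbreviation grid :: "nat \<Rightarrow> nat \<Rightarrow> (nat \<Rightarrow> nat) pair_pre_digraph" where
  "grid d n \<equiv> cartesian_power d (path_graph n)"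

definition weight :: "nat \<Rightarrow> (nat \<Rightarrow> nat) \<Rightarrow> nat" where
  "weight d x = (\<Sum>i<d. x i)"

lemma pverts_grid: "pverts (grid d n) = {..<d} \<rightarrow>\<^sub>E {1..n}"
  by (simp add: cartesian_power_def path_graph_def)

lemma pverts_grid_Suc:
  "pverts (grid (Suc d) n) = (\<lambda>(y, x). x(d := y)) ` ({1..n} \<times> pverts (grid d n))"
  by (simp add: pverts_grid lessThan_Suc PiE_insert_eq)

lemma grid_restrict:
  assumes "x \<in> pverts (grid d n)"
  shows "(x(d := y))(d := undefined) = x"
  using assms by (auto simp: pverts_grid PiE_def extensional_def)

lemma finite_pverts_grid: "finite (pverts (grid d n))"
  by (simp add: pverts_grid finite_PiE)

lemma weight_fun_upd: "weight (Suc d) (x(d := y)) = weight d x + y"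
  by (simp add: weight_def)

lemma weight_arc:
  assumes "(u, v) \<in> parcs (grid d n)"
  shows "weight d u \<le> Suc (weight d v)"
proof -
  obtain i where i: "i < d" "u i \<le> Suc (v i)" "\<forall>j<d. j \<noteq> i \<longrightarrow> u j = v j"
    using assms by (auto simp: cartesian_power_def path_graph_def)
  have "(\<Sum>j\<in>{..<d} - {i}. u j) = (\<Sum>j\<in>{..<d} - {i}. v j)"
    using i by (intro sum.cong) auto
  then show ?thesis
    using i sum.remove[of "{..<d}" i u] sum.remove[of "{..<d}" i v] by (simp add: weight_def)
qed

lemma grid_arc_old_coordinate:
  assumes "(u, v) \<in> parcs (grid d n)" "y \<in> {1..n}"
  shows "(u(d := y), v(d := y)) \<in> parcs (grid (Suc d) n)"
proof -
  obtain i where uv: "u \<in> pverts (grid d n)" "v \<in> pverts (grid d n)"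
    and i: "i < d" "(u i, v i) \<in> parcs (path_graph n)" "\<forall>j<d. j \<noteq> i \<longrightarrow> u j = v j"
    using assms(1) by (auto simp: cartesian_power_def)
  have "u(d := y) \<in> pverts (grid (Suc d) n)" "v(d := y) \<in> pverts (grid (Suc d) n)"
    using uv assms(2) by (auto simp: pverts_grid_Suc)
  moreover have "\<exists>i<Suc d. ((u(d := y)) i, (v(d := y)) i) \<in> parcs (path_graph n) \<and>
      (\<forall>j<Suc d. j \<noteq> i \<longrightarrow> (u(d := y)) j = (v(d := y)) j)"
    using i by (intro exI[of _ i]) auto
  ultimately show ?thesis by (simp add: cartesian_power_def)
qed

lemma grid_arc_new_coordinate:
  assumes "x \<in> pverts (grid d n)" "y \<in> {1..n}" "Suc y \<in> {1..n}"
  shows "(x(d := y), x(d := Suc y)) \<in> parcs (grid (Suc d) n)"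
proof -
  have "x(d := y) \<in> pverts (grid (Suc d) n)" "x(d := Suc y) \<in> pverts (grid (Suc d) n)"
    using assms by (auto simp: pverts_grid_Suc)
  moreover have "\<exists>i<Suc d. ((x(d := y)) i, (x(d := Suc y)) i) \<in> parcs (path_graph n) \<and>
      (\<forall>j<Suc d. j \<noteq> i \<longrightarrow> (x(d := y)) j = (x(d := Suc y)) j)"
    using assms(2,3) by (intro exI[of _ d]) (auto simp: path_graph_def)
  ultimately show ?thesis by (simp add: cartesian_power_def)
qed

section \<open>Symmetric chain decompositions\<close>

text \<open>
  The chain with index \<open>i\<close> has the weights \<open>a i, \<dots>, b i\<close>, and \<open>f i s\<close> is its vertex of weight \<open>s\<close>. The
  reflection of the grid that replaces each coordinate \<open>c\<close> by \<open>n + 1 - c\<close> turns weight \<open>s\<close> into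
  weight \<open>d (n + 1) - s\<close>; this is why \<open>a i + b i = d (n + 1)\<close> expresses symmetry.
\<close>

definition symmetric_chains ::
    "nat \<Rightarrow> nat \<Rightarrow> 'i set \<Rightarrow> ('i \<Rightarrow> nat) \<Rightarrow> ('i \<Rightarrow> nat) \<Rightarrow> ('i \<Rightarrow> nat \<Rightarrow> nat \<Rightarrow> nat) \<Rightarrow> bool" where
  "symmetric_chains d n I a b f \<longleftrightarrow>
    (\<forall>i\<in>I. a i \<le> b i \<and> a i + b i = d * (n + 1) \<and>
      (\<forall>s\<in>{a i..b i}. weight d (f i s) = s) \<and>
      (\<forall>s\<in>{a i..<b i}. (f i s, f i (Suc s)) \<in> parcs (grid d n))) \<and>
    bij_betw (\<lambda>(i, s). f i s) (SIGMA i:I. {a i..b i}) (pverts (grid d n))"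

lemma
  assumes sc: "symmetric_chains d n I a b f" and i: "i \<in> I"
  shows symmetric_chains_bounds: "a i \<le> b i" "a i + b i = d * (n + 1)"
    and symmetric_chains_weight: "a i \<le> s \<Longrightarrow> s \<le> b i \<Longrightarrow> weight d (f i s) = s"
    and symmetric_chains_arc: "a i \<le> s \<Longrightarrow> s < b i \<Longrightarrow> (f i s, f i (Suc s)) \<in> parcs (grid d n)"
    and symmetric_chains_vertex: "a i \<le> s \<Longrightarrow> s \<le> b i \<Longrightarrow> f i s \<in> pverts (grid d n)"
  using sc i bij_betwE[of "\<lambda>(i, s). f i s" "SIGMA i:I. {a i..b i}" "pverts (grid d n)"]
  by (auto simp: symmetric_chains_def)

lemma symmetric_chains_disjoint:
  assumes "symmetric_chains d n I a b f" "f i s = f i' s'"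
    and "i \<in> I" "a i \<le> s" "s \<le> b i" "i' \<in> I" "a i' \<le> s'" "s' \<le> b i'"
  shows "i = i'" "s = s'"
proof -
  have "inj_on (\<lambda>(i, s). f i s) (SIGMA i:I. {a i..b i})"
    using assms(1) by (simp add: symmetric_chains_def bij_betw_def)
  from inj_onD[OF this, of "(i, s)" "(i', s')"] assms show "i = i'" "s = s'" by simp_all
qed

lemma symmetric_chains_cover:
  assumes "symmetric_chains d n I a b f" "x \<in> pverts (grid d n)"
  obtains i s where "i \<in> I" "a i \<le> s" "s \<le> b i" "x = f i s"
proof -
  have "x \<in> (\<lambda>(i, s). f i s) ` (SIGMA i:I. {a i..b i})"
    using assms by (simp add: symmetric_chains_def bij_betw_def)
  then show thesis using that by auto
qed

text \<open>
  The product of a chain with the vertices \<open>f i s\<close>, \<open>a i \<le> s \<le> b i\<close>, and the path \<open>{1..n}\<close> is a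
  rectangle, and it is split into nested hooks. Hook number \<open>j\<close> first climbs along the chain,
  with new coordinate \<open>j + 1\<close>, up to \<open>f i (b i - j)\<close>, and there it raises the new coordinate
  to \<open>n\<close>. At weight \<open>s\<close> it has reached \<open>min (s - 1) (b i) - j\<close> on the chain. Its weights
  run from \<open>a i + j + 1\<close> to \<open>b i - j + n\<close>, which is symmetric again. The new index lists the hook
  numbers chosen so far, which keeps the index type fixed throughout the induction.
\<close>

lemma symmetric_chains_Suc:
  fixes I :: "nat list set"
  assumes sc: "symmetric_chains d n I a b f"
  defines "J \<equiv> {j # i |i j. i \<in> I \<and> j < n \<and> j \<le> b i - a i}"
  defines "z \<equiv> \<lambda>l s. min (s - 1) (b (tl l)) - hd l"
  shows "symmetric_chains (Suc d) n J
    (\<lambda>l. a (tl l) + hd l + 1) (\<lambda>l. b (tl l) - hd l + n) (\<lambda>l s. (f (tl l) (z l s))(d := s - z l s))"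
    (is "symmetric_chains _ _ _ ?a ?b ?f")
proof -
  note ab = symmetric_chains_bounds[OF sc] and wt = symmetric_chains_weight[OF sc]
    and arc = symmetric_chains_arc[OF sc] and vert = symmetric_chains_vertex[OF sc]
  have z: "a (tl l) \<le> z l s" "z l s \<le> b (tl l) - hd l" "1 \<le> s - z l s" "s - z l s \<le> n" "z l s < s"
    "tl l \<in> I" "hd l < n" "hd l \<le> b (tl l) - a (tl l)" "a (tl l) \<le> b (tl l)"
    if l: "l \<in> J" and s: "?a l \<le> s" "s \<le> ?b l" for l s
  proof -
    obtain i j where "l = j # i" "i \<in> I" "j < n" "j \<le> b i - a i"
      using l by (auto simp: J_def)
    then show "a (tl l) \<le> z l s" "z l s \<le> b (tl l) - hd l" "1 \<le> s - z l s" "s - z l s \<le> n"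
      "z l s < s" "tl l \<in> I" "hd l < n" "hd l \<le> b (tl l) - a (tl l)" "a (tl l) \<le> b (tl l)"
      using s ab(1)[of i] by (simp_all add: z_def min_def split: if_splits) linarith+
  qed
  have "bij_betw (\<lambda>(l, s). ?f l s) (SIGMA l:J. {?a l..?b l}) (pverts (grid (Suc d) n))"
    unfolding bij_betw_def
  proof
    show "inj_on (\<lambda>(l, s). ?f l s) (SIGMA l:J. {?a l..?b l})"
    proof (rule inj_onI, clarify)
      fix l s l' s'
      assume eq: "?f l s = ?f l' s'" and "l \<in> J" "s \<in> {?a l..?b l}" "l' \<in> J" "s' \<in> {?a l'..?b l'}"
      then have l: "l \<in> J" "?a l \<le> s" "s \<le> ?b l" and l': "l' \<in> J" "?a l' \<le> s'" "s' \<le> ?b l'"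
        by simp_all
      have vertex: "a (tl m) \<le> z m t" "z m t \<le> b (tl m)"
        and restrict: "(?f m t)(d := undefined) = f (tl m) (z m t)"
        if "m \<in> J" "?a m \<le> t" "t \<le> ?b m" for m t
      proof -
        show ac: "a (tl m) \<le> z m t" and bc: "z m t \<le> b (tl m)" using z(1,2)[OF that] by linarith+
        show "(?f m t)(d := undefined) = f (tl m) (z m t)"
          by (rule grid_restrict[OF vert[OF z(6)[OF that] ac bc]])
      qed
      have "f (tl l) (z l s) = f (tl l') (z l' s')"
        using restrict[OF l] restrict[OF l'] eq by metis
      then have same: "tl l = tl l'" "z l s = z l' s'"
        using symmetric_chains_disjoint[OF sc] vertex[OF l] vertex[OF l'] z(6)[OF l] z(6)[OF l']
        by blast+
      have "s - z l s = s' - z l' s'" using fun_cong[OF eq, of d] by simp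
      then have s: "s = s'" using same(2) z(5)[OF l] z(5)[OF l'] by linarith
      \<comment> \<open>On hook \<open>j\<close> the new coordinate is \<open>j + 1\<close>, or else the chain is at weight \<open>b i - j\<close>. Each
        equation proposes a value for \<open>j\<close>; the smaller one is correct.\<close>
      have hook: "hd m = min (t - z m t - 1) (b (tl m) - z m t)"
        if "m \<in> J" "?a m \<le> t" "t \<le> ?b m" for m t
        using z(1,2,3,8,9)[OF that] that(2)
        by (simp add: z_def min_def split: if_splits) arith
      have "hd l = hd l'" using hook[OF l] hook[OF l'] same s by simp
      moreover have "l \<noteq> []" "l' \<noteq> []" using l l' by (auto simp: J_def)
      ultimately show "l = l' \<and> s = s'" using same(1) s by (simp add: list.expand)
    qed
    show "(\<lambda>(l, s). ?f l s) ` (SIGMA l:J. {?a l..?b l}) = pverts (grid (Suc d) n)"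
    proof (intro equalityI subsetI)
      fix v assume "v \<in> (\<lambda>(l, s). ?f l s) ` (SIGMA l:J. {?a l..?b l})"
      then obtain l s where l: "l \<in> J" "?a l \<le> s" "s \<le> ?b l" and v: "v = ?f l s" by auto
      have "f (tl l) (z l s) \<in> pverts (grid d n)" using vert z[OF l] by simp
      then show "v \<in> pverts (grid (Suc d) n)" using z[OF l] v by (auto simp: pverts_grid_Suc)
    next
      fix v assume "v \<in> pverts (grid (Suc d) n)"
      then obtain y x where y: "1 \<le> y" "y \<le> n" and x: "x \<in> pverts (grid d n)"
        and v: "v = x(d := y)"
        by (auto simp: pverts_grid_Suc)
      obtain i t where it: "i \<in> I" "a i \<le> t" "t \<le> b i" "x = f i t"
        using symmetric_chains_cover[OF sc x] .
      define j where "j = min (y - 1) (b i - t)"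
      have "j # i \<in> J" using it y by (auto simp: J_def j_def)
      moreover have "z (j # i) (t + y) = t" using it y by (auto simp: z_def j_def min_def)
      moreover have "t + y \<in> {?a (j # i)..?b (j # i)}" using it y by (auto simp: j_def min_def)
      ultimately show "v \<in> (\<lambda>(l, s). ?f l s) ` (SIGMA l:J. {?a l..?b l})"
        using it v by (intro image_eqI[of _ _ "(j # i, t + y)"]) auto
    qed
  qed
  moreover have "?a l \<le> ?b l \<and> ?a l + ?b l = Suc d * (n + 1)" if "l \<in> J" for l
  proof -
    obtain i j where "l = j # i" "i \<in> I" "j < n" "j \<le> b i - a i"
      using \<open>l \<in> J\<close> by (auto simp: J_def)
    then show ?thesis using ab[of i] by simp
  qed
  moreover have "weight (Suc d) (?f l s) = s" if "l \<in> J" "s \<in> {?a l..?b l}" for l s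
  proof -
    have l: "l \<in> J" "?a l \<le> s" "s \<le> ?b l" using that by simp_all
    have "weight d (f (tl l) (z l s)) = z l s"
      using wt[OF z(6)[OF l] z(1)[OF l]] z(2)[OF l] by linarith
    then show ?thesis using z(5)[OF l] by (simp add: weight_fun_upd)
  qed
  moreover have "(?f l s, ?f l (Suc s)) \<in> parcs (grid (Suc d) n)"
    if l: "l \<in> J" and s: "s \<in> {?a l..<?b l}" for l s
  proof -
    have "?a l \<le> s" "s \<le> ?b l" "?a l \<le> Suc s" "Suc s \<le> ?b l" using s by auto
    note zl = z[OF l this(1,2)] and zl' = z[OF l this(3,4)]
    have y: "s - z l s \<in> {1..n}" "Suc s - z l (Suc s) \<in> {1..n}"
      using zl(3,4) zl'(3,4) by simp_all
    show ?thesis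
    proof (cases "s \<le> b (tl l)")
      case True
      then have up: "z l (Suc s) = Suc (z l s)"
        using zl(5,8,9) zl'(1) \<open>?a l \<le> s\<close> unfolding z_def by auto
      then have "z l s < b (tl l)" using zl'(2) by linarith
      from grid_arc_old_coordinate[OF arc[OF zl(6,1) this] y(1)] show ?thesis by (simp add: up)
    next
      case False
      then have stay: "z l (Suc s) = z l s" unfolding z_def by auto
      have "z l s \<le> b (tl l)" using zl(2) by linarith
      moreover have "Suc s - z l s = Suc (s - z l s)" using zl(5) by simp
      ultimately show ?thesis
        using grid_arc_new_coordinate[OF vert[OF zl(6,1)] y(1)] y(2) by (simp add: stay)
    qed
  qed
  ultimately show ?thesis unfolding symmetric_chains_def by blast
qed

lemma symmetric_chains_exist: "\<exists>(I :: nat list set) a b f. symmetric_chains d n I a b f"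
proof (induction d)
  case 0
  have "symmetric_chains 0 n {[] :: nat list} (\<lambda>_. 0) (\<lambda>_. 0) (\<lambda>_ _ _. undefined)"
    by (auto simp: symmetric_chains_def weight_def pverts_grid bij_betw_def)
  then show ?case by blast
next
  case (Suc d)
  then show ?case using symmetric_chains_Suc by blast
qed

text \<open>Each chain meets the middle layer in exactly one vertex, because \<open>a i \<le> d (n + 1) / 2 \<le> b i\<close>.\<close>

lemma symmetric_chains_meet_middle_layer:
  assumes sc: "symmetric_chains d n I a b f"
  shows "bij_betw (\<lambda>i. f i (d * (n + 1) div 2)) I
    {x \<in> pverts (grid d n). weight d x = d * (n + 1) div 2}" (is "bij_betw ?g I ?M")
proof -
  let ?m = "d * (n + 1) div 2"
  note wt = symmetric_chains_weight[OF sc]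
  have mid: "a i \<le> ?m" "?m \<le> b i" if "i \<in> I" for i
    using symmetric_chains_bounds[OF sc that] by linarith+
  show ?thesis unfolding bij_betw_def
  proof
    show "inj_on ?g I"
    proof (rule inj_onI)
      fix i i' assume "i \<in> I" "i' \<in> I" "?g i = ?g i'"
      then show "i = i'" using symmetric_chains_disjoint(1)[OF sc] mid by blast
    qed
    have "?g i \<in> ?M" if "i \<in> I" for i
      using symmetric_chains_vertex[OF sc that] mid[OF that] wt that by auto
    moreover have "x \<in> ?g ` I" if x: "x \<in> ?M" for x
    proof -
      obtain i s where "i \<in> I" "a i \<le> s" "s \<le> b i" "x = f i s"
        using symmetric_chains_cover[OF sc] x by blast
      then show ?thesis using wt x by auto
    qed
    ultimately show "?g ` I = ?M" by blast
  qed
qed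

text \<open>Clamping the time to \<open>{a i..b i}\<close> makes a cop wait at the two ends of her chain.\<close>

lemma cop_number_inf_grid_le_middle_layer:
  "cop_number_inf (grid d n) \<le> card {x \<in> pverts (grid d n). weight d x = d * (n + 1) div 2}"
proof -
  obtain I :: "nat list set" and a b f where sc: "symmetric_chains d n I a b f"
    using symmetric_chains_exist by blast
  note mid = symmetric_chains_meet_middle_layer[OF sc]
  note ab = symmetric_chains_bounds(1)[OF sc]
  define w where "w i t = f i (max (a i) (min t (b i)))" for i t
  have "cops_win (grid d n) (card I)"
  proof (rule cops_win_layer_sweep[where \<rho> = "weight d" and w = w])
    show "finite I" using bij_betw_finite[OF mid] finite_pverts_grid by simp
    fix i assume i: "i \<in> I"
    show "w i 0 \<in> pverts (grid d n)"
      using symmetric_chains_vertex[OF sc i] ab[OF i] by (simp add: w_def)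
    fix t
    show "w i t = w i (Suc t) \<or> (w i t, w i (Suc t)) \<in> parcs (grid d n)"
    proof (cases "a i \<le> t \<and> t < b i")
      case True
      then show ?thesis using symmetric_chains_arc[OF sc i, of t] by (simp add: w_def)
    next
      case False
      then have "max (a i) (min t (b i)) = max (a i) (min (Suc t) (b i))"
        using ab[OF i] by (auto simp: max_def min_def)
      then show ?thesis by (simp add: w_def)
    qed
  next
    fix v assume v: "v \<in> pverts (grid d n)"
    obtain i s where i: "i \<in> I" "a i \<le> s" "s \<le> b i" and "v = f i s"
      using symmetric_chains_cover[OF sc v] .
    then have "w i (weight d v) = v"
      using symmetric_chains_weight[OF sc i] by (simp add: w_def)
    with i(1) show "\<exists>i\<in>I. w i (weight d v) = v" by blast
  qed (use finite_pverts_grid weight_arc in auto)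
  then show ?thesis
    unfolding cop_number_inf_def bij_betw_same_card[OF mid, symmetric] by (rule Least_le)
qed

section \<open>Counting the middle layer\<close>

text \<open>
  The number of compositions of \<open>s\<close> into \<open>e + 1\<close> positive parts. Integer arguments allow
  \<open>s - k n\<close> to become negative, where the number is zero.
\<close>

definition compositions :: "nat \<Rightarrow> int \<Rightarrow> real" where
  "compositions e s = (if s \<ge> 1 then real (nat (s - 1) choose e) else 0)"

lemma compositions_Suc_diff:
  "compositions (Suc e) s - compositions (Suc e) (s - 1) = compositions e (s - 1)"
proof (cases "s \<ge> 2")
  case True
  then have "nat (s - 1) = Suc (nat (s - 1 - 1))" by simp
  then show ?thesis using True by (simp add: compositions_def)
qed (auto simp: compositions_def)

text \<open>
  Compositions whose last part \<open>y\<close> is at most \<open>n\<close>: those with a larger last part become arbitrary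
  compositions of \<open>s - n\<close> when \<open>n\<close> is subtracted from it.
\<close>

lemma sum_compositions:
  "(\<Sum>y = 1..n. compositions e (s - int y)) =
    compositions (Suc e) s - compositions (Suc e) (s - int n)"
proof (induction n)
  case (Suc n)
  have "compositions e (s - int (Suc n)) =
      compositions (Suc e) (s - int n) - compositions (Suc e) (s - int (Suc n))"
    using compositions_Suc_diff[of e "s - int n"] by (simp add: algebra_simps)
  with Suc show ?case by simp
qed simp

lemma card_layer_Suc:
  "card {x \<in> pverts (grid (Suc d) n). weight (Suc d) x = s} =
    (\<Sum>y = 1..n. if y \<le> s then card {x \<in> pverts (grid d n). weight d x = s - y} else 0)"
proof -
  let ?S = "SIGMA y:{1..n}. {x \<in> pverts (grid d n). weight d x + y = s}"
  have "inj_on (\<lambda>(y, x). x(d := y)) ?S"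
  proof (rule inj_onI, clarify)
    fix y x y' x' assume "x(d := y) = x'(d := y')" "x \<in> pverts (grid d n)" "x' \<in> pverts (grid d n)"
    then show "y = y' \<and> x = x'" by (metis fun_upd_same grid_restrict)
  qed
  moreover have "{x \<in> pverts (grid (Suc d) n). weight (Suc d) x = s} = (\<lambda>(y, x). x(d := y)) ` ?S"
    by (auto simp: pverts_grid_Suc weight_fun_upd image_iff)
  ultimately have "card {x \<in> pverts (grid (Suc d) n). weight (Suc d) x = s} = card ?S"
    by (simp add: card_image)
  also have "\<dots> = (\<Sum>y = 1..n. card {x \<in> pverts (grid d n). weight d x + y = s})"
    using finite_pverts_grid by (intro card_SigmaI) auto
  also have "\<dots> = (\<Sum>y = 1..n. if y \<le> s then card {x \<in> pverts (grid d n). weight d x = s - y} else 0)"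
  proof (intro sum.cong refl)
    fix y
    have "{x \<in> pverts (grid d n). weight d x + y = s} =
        (if y \<le> s then {x \<in> pverts (grid d n). weight d x = s - y} else {})" by auto
    then show "card {x \<in> pverts (grid d n). weight d x + y = s} =
        (if y \<le> s then card {x \<in> pverts (grid d n). weight d x = s - y} else 0)" by simp
  qed
  finally show ?thesis .
qed

text \<open>
  Inclusion and exclusion, done one coordinate at a time: summing over the last coordinate turns
  the term for \<open>k\<close> into the difference of two terms, and Pascal's rule collects them.
\<close>

lemma card_layer:
  assumes "1 \<le> n"
  shows "real (card {x \<in> pverts (grid (Suc e) n). weight (Suc e) x = s}) =
    (\<Sum>k\<le>Suc e. (- 1) ^ k * real (Suc e choose k) * compositions e (int s - int k * int n))"
proof (induction e arbitrary: s)
  case 0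
  have "{x \<in> pverts (grid 0 n). weight 0 x = t} = (if t = 0 then {\<lambda>_. undefined} else {})" for t
    by (auto simp: pverts_grid weight_def)
  then have "card {x \<in> pverts (grid (Suc 0) n). weight (Suc 0) x = s} =
      (\<Sum>y = 1..n. if y = s then 1 else 0)"
    unfolding card_layer_Suc by (intro sum.cong) auto
  then show ?case using assms by (auto simp: compositions_def)
next
  case (Suc e)
  let ?c = "\<lambda>s. \<Sum>k\<le>Suc e. (- 1) ^ k * real (Suc e choose k) * compositions e (s - int k * int n)"
  let ?g = "\<lambda>k. compositions (Suc e) (int s - int k * int n)"
  have "real (card {x \<in> pverts (grid (Suc (Suc e)) n). weight (Suc (Suc e)) x = s}) =
      (\<Sum>y = 1..n. ?c (int s - int y))"
    unfolding card_layer_Suc[of "Suc e"] of_nat_sum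
  proof (intro sum.cong refl)
    fix y
    have "compositions e (int s - int y - int k * int n) = 0" if "\<not> y \<le> s" for k
    proof -
      have "0 \<le> int k * int n" by simp
      then have "int s - int y - int k * int n < 1" using that by linarith
      then show ?thesis by (simp add: compositions_def)
    qed
    then show "real (if y \<le> s then card {x \<in> pverts (grid (Suc e) n). weight (Suc e) x = s - y} else 0) =
        ?c (int s - int y)"
      using Suc[of "s - y"] by (simp add: of_nat_diff del: sum.atMost_Suc)
  qed
  also have "\<dots> = (\<Sum>k\<le>Suc e. (- 1) ^ k * real (Suc e choose k) *
      (\<Sum>y = 1..n. compositions e ((int s - int k * int n) - int y)))"
    by (subst sum.swap) (simp add: sum_distrib_left algebra_simps del: sum.atMost_Suc)
  also have "\<dots> = (\<Sum>k\<le>Suc e. (- 1) ^ k * real (Suc e choose k) * (?g k - ?g (Suc k)))"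
  proof -
    have "int s - int k * int n - int n = int s - int (Suc k) * int n" for k
      by (simp add: algebra_simps)
    then show ?thesis by (simp only: sum_compositions)
  qed
  also have "\<dots> = (\<Sum>k\<le>Suc e. (- 1) ^ k * real (Suc e choose k) * ?g k) +
      (\<Sum>k\<le>Suc e. (- 1) ^ Suc k * real (Suc e choose k) * ?g (Suc k))"
    by (simp add: right_diff_distrib sum_subtractf sum_negf del: sum.atMost_Suc)
  also have "(\<Sum>k\<le>Suc e. (- 1) ^ k * real (Suc e choose k) * ?g k) =
      (\<Sum>k\<le>Suc (Suc e). (- 1) ^ k * real (Suc e choose k) * ?g k)"
    by (simp add: binomial_eq_0)
  also have "\<dots> = ?g 0 + (\<Sum>k\<le>Suc e. (- 1) ^ Suc k * real (Suc e choose Suc k) * ?g (Suc k))"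
    by (subst sum.atMost_Suc_shift) (simp del: sum.atMost_Suc)
  also have "\<dots> + (\<Sum>k\<le>Suc e. (- 1) ^ Suc k * real (Suc e choose k) * ?g (Suc k)) =
      ?g 0 + (\<Sum>k\<le>Suc e. (- 1) ^ Suc k * real (Suc (Suc e) choose Suc k) * ?g (Suc k))"
    unfolding add.assoc sum.distrib[symmetric]
    by (simp add: algebra_simps del: sum.atMost_Suc of_nat_Suc)
  also have "\<dots> = (\<Sum>k\<le>Suc (Suc e). (- 1) ^ k * real (Suc (Suc e) choose k) * ?g k)"
    by (subst sum.atMost_Suc_shift[of _ "Suc e"]) (simp del: sum.atMost_Suc)
  finally show ?case .
qed

text \<open>
  For \<open>k > d / 2\<close> the term vanishes, since \<open>\<lfloor>d (n + 1) / 2\<rfloor> - k n \<le> (d - n) / 2 < d\<close> is too small to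
  be a sum of \<open>d\<close> positive parts.
\<close>

lemma card_middle_layer:
  assumes "1 \<le> d" "1 \<le> n"
  shows "real (card {x \<in> pverts (grid d n). weight d x = d * (n + 1) div 2}) =
    (\<Sum>k = 0..d div 2. (- 1) ^ k * real (d choose k) *
      real ((d * (n + 1) div 2 - k * n - 1) choose (d - 1)))"
proof -
  let ?m = "d * (n + 1) div 2"
  obtain e where e: "d = Suc e" using assms(1) by (cases d) auto
  have "real (card {x \<in> pverts (grid d n). weight d x = ?m}) =
      (\<Sum>k\<le>d. (- 1) ^ k * real (d choose k) * compositions e (int ?m - int k * int n))"
    using card_layer[OF assms(2), of e ?m] unfolding e .
  also have "\<dots> = (\<Sum>k = 0..d div 2. (- 1) ^ k * real (d choose k) *
      compositions e (int ?m - int k * int n))"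
  proof (rule sum.mono_neutral_right)
    show "\<forall>k\<in>{..d} - {0..d div 2}.
        (- 1) ^ k * real (d choose k) * compositions e (int ?m - int k * int n) = 0"
    proof
      fix k assume "k \<in> {..d} - {0..d div 2}"
      then have "Suc d \<le> 2 * k" by auto
      then have "Suc d * n \<le> 2 * k * n" by (rule mult_right_mono) simp
      then have "2 * int ?m - 2 * (int k * int n) \<le> int d - int n"
        by (simp add: algebra_simps flip: of_nat_mult of_nat_add)
      then have "compositions e (int ?m - int k * int n) = 0"
        using assms e by (auto simp: compositions_def)
      then show "(- 1) ^ k * real (d choose k) * compositions e (int ?m - int k * int n) = 0" by simp
    qed
  qed auto
  also have "\<dots> = (\<Sum>k = 0..d div 2. (- 1) ^ k * real (d choose k) *
      real ((?m - k * n - 1) choose (d - 1)))"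
  proof (intro sum.cong refl)
    fix k assume "k \<in> {0..d div 2}"
    moreover have "\<lfloor>real (d * (n + 1)) / 2\<rfloor> = int ?m"
      using floor_divide_of_nat_eq[of "d * (n + 1)" 2] by simp
    ultimately have "int (?m - k * n - 1) = int ?m - int k * int n - 1"
      using middle_layer_upper_index[OF assms, of k] by (metis atLeastAtMost_iff)
    then have "int ?m - int k * int n = int (?m - k * n - 1) + 1"
      by (metis diff_add_cancel)
    then have "compositions e (int ?m - int k * int n) = real ((?m - k * n - 1) choose (d - 1))"
      unfolding compositions_def by (simp add: e)
    then show "(- 1) ^ k * real (d choose k) * compositions e (int ?m - int k * int n) =
        (- 1) ^ k * real (d choose k) * real ((?m - k * n - 1) choose (d - 1))" by simp
  qed
  finally show ?thesis .
qed

theorem theorem3p8: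
  fixes d :: nat
  assumes "d \<ge> 1"
  shows "\<exists>\<epsilon> :: nat \<Rightarrow> real. \<epsilon> \<longlonglongrightarrow> 0 \<and>
    (\<forall>n\<ge>1. real (cop_number_inf (cartesian_power d (path_graph n))) \<le>
      (1 + \<epsilon> n) * (\<Sum>k = 0..d div 2. (- 1) ^ k * real (d choose k) *
        real ((d * (n + 1) div 2 - k * n - 1) choose (d - 1))))"
proof (intro exI[of _ "\<lambda>_. 0 :: real"] conjI allI impI)
  fix n :: nat assume "1 \<le> n"
  with assms show "real (cop_number_inf (grid d n)) \<le>
      (1 + 0) * (\<Sum>k = 0..d div 2. (- 1) ^ k * real (d choose k) *
        real ((d * (n + 1) div 2 - k * n - 1) choose (d - 1)))"
    using cop_number_inf_grid_le_middle_layer[of d n] card_middle_layer[of d n] by simp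
qed simp

end
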